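(* Let $V_{\mathbb H}^R$ be a separable right quaternionic Hilbert space and $A\in\mathcal B(V_{\mathbb H}^R)$. Then $A$ is Fredholm if and only if $\pi(A)$ is invertible in the Calkin algebra $\mathcal B(V_{\mathbb H}^R)/\mathcal B_0(V_{\mathbb H}^R)$.
   Context: $\mathbb H$ denotes the quaternions. A right quaternionic Hilbert space is a right $\mathbb H$-vector space, complete for the norm of an $\mathbb H$-valued inner product $\langle\cdot|\cdot\rangle$ satisfying $\overline{\langle\phi|\psi\rangle}=\langle\psi|\phi\rangle$, $\|\phi\|^2=\langle\phi|\phi\rangle>0$ for $\phi\ne0$, additivity, $\langle\phi|\psi\mathfrak q\rangle=\langle\phi|\psi\rangle\mathfrak q$ and $\langle\phi\mathfrak q|\psi\rangle=\overline{\mathfrak q}\langle\phi|\psi\rangle$. $\mathcal B(V_{\mathbb H}^R)$ is the algebra of bounded right $\mathbb H$-linear operators on $V_{\mathbb H}^R$ and $\mathcal B_0(V_{\mathbb H}^R)$ is the closed two-sided ideal of compact operators (closure of the image of the closed unit ball is compact). The Calkin algebra is the quotient unital Banach algebra $\mathcal B(V_{\mathbb H}^R)/\mathcal B_0(V_{\mathbb H}^R)$, and $\pi$ is the quotient map. $A\in\mathcal B(V_{\mathbb H}^R)$ is Fredholm if $\ker(A)$ and $V_{\mathbb H}^R/\mathrm{ran}(A)$ are finite dimensional over $\mathbb H$. *)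

theory Defs
  imports "HOL-Analysis.Analysis" "HOL-Algebra.QuotRing" "HOL-Algebra.Module"
begin

section \<open>Quaternions\<close>

datatype quat = Quat (q_re: real) (q_i: real) (q_j: real) (q_k: real)

instantiation quat :: real_algebra_1
begin

definition "0 = Quat 0 0 0 0"
definition "1 = Quat 1 0 0 0"
definition "p + q = Quat (q_re p + q_re q) (q_i p + q_i q) (q_j p + q_j q) (q_k p + q_k q)"
definition "- q = Quat (- q_re q) (- q_i q) (- q_j q) (- q_k q)"
definition "(p::quat) - q = p + - q"
definition "p * q = Quat
  (q_re p * q_re q - q_i p * q_i q - q_j p * q_j q - q_k p * q_k q)
  (q_re p * q_i q + q_i p * q_re q + q_j p * q_k q - q_k p * q_j q)
  (q_re p * q_j q - q_i p * q_k q + q_j p * q_re q + q_k p * q_i q)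
  (q_re p * q_k q + q_i p * q_j q - q_j p * q_i q + q_k p * q_re q)"
definition "r *\<^sub>R q = Quat (r * q_re q) (r * q_i q) (r * q_j q) (r * q_k q)"

lemmas quat_defs = zero_quat_def one_quat_def plus_quat_def uminus_quat_def
  minus_quat_def times_quat_def scaleR_quat_def

instance
  by standard (auto simp: quat_defs algebra_simps)

end

definition q_cnj :: "quat \<Rightarrow> quat"
  where "q_cnj q = Quat (q_re q) (- q_i q) (- q_j q) (- q_k q)"

definition q_normsq :: "quat \<Rightarrow> real"
  where "q_normsq q = (q_re q)\<^sup>2 + (q_i q)\<^sup>2 + (q_j q)\<^sup>2 + (q_k q)\<^sup>2"

lemma q_normsq_eq_0_iff: "q_normsq q = 0 \<longleftrightarrow> q = 0"
  by (cases q) (auto simp: q_normsq_def quat_defs add_nonneg_eq_0_iff)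

lemma mult_q_cnj: "q * q_cnj q = of_real (q_normsq q)" "q_cnj q * q = of_real (q_normsq q)"
  by (auto simp: q_normsq_def q_cnj_def of_real_def quat_defs power2_eq_square algebra_simps)

instantiation quat :: real_div_algebra
begin

definition "inverse q = inverse (q_normsq q) *\<^sub>R q_cnj q"
definition "p div q = p * inverse (q :: quat)"

instance
proof
  fix q :: quat
  assume "q \<noteq> 0"
  then have "q_normsq q \<noteq> 0" by (simp add: q_normsq_eq_0_iff)
  then show "inverse q * q = 1" "q * inverse q = 1"
    by (simp_all add: inverse_quat_def mult_q_cnj of_real_def)
next
  show "inverse (0 :: quat) = 0"
    by (simp add: inverse_quat_def q_cnj_def quat_defs)
qed (simp add: divide_quat_def)

end


section \<open>Right quaternionic Hilbert spaces\<close>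

class right_quat_vector = ab_group_add +
  fixes scaleQ :: "'a \<Rightarrow> quat \<Rightarrow> 'a"  (infixl \<open>\<cdot>\<^sub>Q\<close> 75)
  assumes scaleQ_add_left: "(x + y) \<cdot>\<^sub>Q q = x \<cdot>\<^sub>Q q + y \<cdot>\<^sub>Q q"
    and scaleQ_add_right: "x \<cdot>\<^sub>Q (p + q) = x \<cdot>\<^sub>Q p + x \<cdot>\<^sub>Q q"
    and scaleQ_scaleQ: "x \<cdot>\<^sub>Q (p * q) = (x \<cdot>\<^sub>Q p) \<cdot>\<^sub>Q q"
    and scaleQ_one: "x \<cdot>\<^sub>Q 1 = x"

(* Positive definiteness of the inner product is contained in qinner_self together with
   norm_eq_zero.  The real scalar multiplication is the one of the underlying real space. *)
class right_quat_inner = right_quat_vector + real_normed_vector +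
  fixes qinner :: "'a \<Rightarrow> 'a \<Rightarrow> quat"
  assumes scaleR_scaleQ: "r *\<^sub>R x = x \<cdot>\<^sub>Q of_real r"
    and qinner_cnj: "q_cnj (qinner x y) = qinner y x"
    and qinner_self: "qinner x x = of_real ((norm x)\<^sup>2)"
    and qinner_add_right: "qinner x (y + z) = qinner x y + qinner x z"
    and qinner_scaleQ_right: "qinner x (y \<cdot>\<^sub>Q q) = qinner x y * q"
    and qinner_scaleQ_left: "qinner (x \<cdot>\<^sub>Q q) y = q_cnj q * qinner x y"

class right_quat_hilbert = right_quat_inner + complete_space
begin
subclass banach ..
end


section \<open>Bounded and compact operators, the Calkin algebra\<close>

definition bounded_right_linear ::
    "('v::right_quat_hilbert \<Rightarrow> 'v) \<Rightarrow> bool"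
  where "bounded_right_linear A \<longleftrightarrow>
    bounded_linear A \<and> (\<forall>x q. A (x \<cdot>\<^sub>Q q) = A x \<cdot>\<^sub>Q q)"

definition bounded_ops :: "('v::right_quat_hilbert \<Rightarrow> 'v) ring"
  where "bounded_ops =
    \<lparr>carrier = {A. bounded_right_linear A}, mult = (\<lambda>A B. A \<circ> B), one = id,
     zero = (\<lambda>x. 0), add = (\<lambda>A B x. A x + B x)\<rparr>"

definition compact_ops :: "('v::right_quat_hilbert \<Rightarrow> 'v) set"
  where "compact_ops = {A. bounded_right_linear A \<and> compact (closure (A ` cball 0 1))}"

lemma ring_bounded_ops: "ring (bounded_ops :: ('v::right_quat_hilbert \<Rightarrow> 'v) ring)"
proof -
  have 1: "bounded_right_linear (\<lambda>x. A x + B x)"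
    if "bounded_right_linear A" "bounded_right_linear B" for A B :: "'v \<Rightarrow> 'v"
    using that by (auto simp: bounded_right_linear_def bounded_linear_add scaleQ_add_left)
  have 2: "bounded_right_linear (A \<circ> B)"
    if "bounded_right_linear A" "bounded_right_linear B" for A B :: "'v \<Rightarrow> 'v"
    using that by (auto simp: bounded_right_linear_def o_def bounded_linear_compose)
  have z: "0 \<cdot>\<^sub>Q q = (0::'v)" for q
    using scaleQ_add_left[of "0::'v" 0 q] by simp
  have m: "(- x) \<cdot>\<^sub>Q q = - (x \<cdot>\<^sub>Q q)" for x :: 'v and q
    using scaleQ_add_left[of "x::'v" "-x" q] z[of q] by (simp add: eq_neg_iff_add_eq_0 add.commute)
  have 3: "bounded_right_linear (\<lambda>x. 0 :: 'v)" "bounded_right_linear (id :: 'v \<Rightarrow> 'v)"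
    by (auto simp: bounded_right_linear_def z id_def)
  have 4: "bounded_right_linear (\<lambda>x. - A x)" if "bounded_right_linear A" for A :: "'v \<Rightarrow> 'v"
    using that by (auto simp: bounded_right_linear_def bounded_linear_minus m)
  have add: "A (x + y) = A x + A y" if "bounded_right_linear A" for A :: "'v \<Rightarrow> 'v" and x y
    using that by (auto simp: bounded_right_linear_def intro: linear_simps)
  show ?thesis
  proof (rule ringI)
    show "abelian_group (bounded_ops :: ('v \<Rightarrow> 'v) ring)"
    proof (rule abelian_groupI)
      fix A :: "'v \<Rightarrow> 'v" assume "A \<in> carrier bounded_ops"
      then show "\<exists>B\<in>carrier bounded_ops. B \<oplus>\<^bsub>bounded_ops\<^esub> A = \<zero>\<^bsub>bounded_ops\<^esub>"
        by (intro bexI[of _ "\<lambda>x. - A x"]) (auto simp: bounded_ops_def 4)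
    qed (auto simp: bounded_ops_def 1 3 algebra_simps)
    show "Group.monoid (bounded_ops :: ('v \<Rightarrow> 'v) ring)"
      by (rule monoidI) (auto simp: bounded_ops_def 2 3 o_assoc)
  qed (auto simp: bounded_ops_def o_def add)
qed

lemma ideal_compact_ops:
  "ideal (compact_ops :: ('v::right_quat_hilbert \<Rightarrow> 'v) set) bounded_ops"
proof (rule idealI[OF ring_bounded_ops])
  let ?R = "bounded_ops :: ('v \<Rightarrow> 'v) ring"
  interpret ring ?R by (rule ring_bounded_ops)
  have cpt: "compact (closure S)" if "S \<subseteq> T" "compact T" for S T :: "'v set"
    using that closed_Int_compact[of "closure S" T]
    by (metis closed_closure closure_minimal compact_imp_closed inf.absorb1)
  have mem: "A \<in> compact_ops \<longleftrightarrow> A \<in> carrier ?R \<and> compact (closure (A ` cball 0 1))" for A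
    by (auto simp: compact_ops_def bounded_ops_def)
  have cont: "continuous_on S A" if "A \<in> carrier ?R" for A S
    using that by (auto simp: bounded_ops_def bounded_right_linear_def linear_continuous_on)
  have add: "A \<oplus>\<^bsub>?R\<^esub> B = (\<lambda>x. A x + B x)" for A B by (simp add: bounded_ops_def)
  have mult: "A \<otimes>\<^bsub>?R\<^esub> B = A \<circ> B" for A B by (simp add: bounded_ops_def)
  have plus: "A \<oplus>\<^bsub>?R\<^esub> B \<in> compact_ops" if "A \<in> compact_ops" "B \<in> compact_ops" for A B
  proof -
    let ?T = "{x + y |x y. x \<in> closure (A ` cball 0 1) \<and> y \<in> closure (B ` cball 0 1)}"
    have "(A \<oplus>\<^bsub>?R\<^esub> B) ` cball 0 1 \<subseteq> ?T"
      unfolding add using closure_subset[of "A ` cball 0 1"] closure_subset[of "B ` cball 0 1"]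
      by blast
    moreover have "compact ?T" using that by (intro compact_sums) (auto simp: mem)
    ultimately have "compact (closure ((A \<oplus>\<^bsub>?R\<^esub> B) ` cball 0 1))" by (rule cpt)
    then show ?thesis using that by (simp add: mem)
  qed
  have left: "B \<otimes>\<^bsub>?R\<^esub> A \<in> compact_ops" if "A \<in> compact_ops" "B \<in> carrier ?R" for A B
  proof -
    have "(B \<otimes>\<^bsub>?R\<^esub> A) ` cball 0 1 \<subseteq> B ` closure (A ` cball 0 1)"
      unfolding mult image_comp [symmetric] by (intro image_mono closure_subset)
    moreover have "compact (B ` closure (A ` cball 0 1))"
      using that by (intro compact_continuous_image cont) (auto simp: mem)
    ultimately have "compact (closure ((B \<otimes>\<^bsub>?R\<^esub> A) ` cball 0 1))" by (rule cpt)
    then show ?thesis using that by (simp add: mem)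
  qed
  have right: "A \<otimes>\<^bsub>?R\<^esub> B \<in> compact_ops" if "A \<in> compact_ops" "B \<in> carrier ?R" for A B
  proof -
    have "bounded_linear B" using that by (auto simp: bounded_ops_def bounded_right_linear_def)
    then obtain K where K: "K > 0" "\<And>x. norm (B x) \<le> norm x * K"
      using bounded_linear.pos_bounded by blast
    have lin: "linear A" using that
      by (auto simp: compact_ops_def bounded_right_linear_def bounded_linear.linear)
    let ?T = "(\<lambda>x. K *\<^sub>R x) ` closure (A ` cball 0 1)"
    have "(A \<otimes>\<^bsub>?R\<^esub> B) ` cball 0 1 \<subseteq> ?T"
    proof
      fix y assume "y \<in> (A \<otimes>\<^bsub>?R\<^esub> B) ` cball 0 1"
      then obtain x where x: "norm x \<le> 1" "y = A (B x)" by (auto simp: mult)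
      let ?z = "inverse K *\<^sub>R B x"
      have "norm (B x) \<le> K" using K(2)[of x] x(1) K(1)
        by (smt (verit) mult_left_le_one_le norm_ge_zero)
      then have "?z \<in> cball 0 1" using K(1) by (simp add: field_simps)
      then have "A ?z \<in> closure (A ` cball 0 1)" by (intro closure_subset[THEN subsetD] imageI)
      moreover have "y = K *\<^sub>R A ?z" using x K(1) by (simp add: linear_cmul[OF lin])
      ultimately show "y \<in> ?T" by blast
    qed
    moreover have "compact ?T"
      using that by (intro compact_scaling) (auto simp: mem)
    ultimately have "compact (closure ((A \<otimes>\<^bsub>?R\<^esub> B) ` cball 0 1))" by (rule cpt)
    then show ?thesis using that by (simp add: mem)
  qed
  have zero: "\<zero>\<^bsub>?R\<^esub> \<in> compact_ops"
    using cpt[of "(\<lambda>x. 0) ` cball 0 1" "{0}"] zero_closed by (auto simp: mem bounded_ops_def)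
  show "subgroup compact_ops (add_monoid ?R)"
  proof (rule add.subgroupI)
    fix A assume A: "A \<in> (compact_ops :: ('v \<Rightarrow> 'v) set)"
    then have "\<ominus>\<^bsub>?R\<^esub> A = (\<ominus>\<^bsub>?R\<^esub> \<one>\<^bsub>?R\<^esub>) \<otimes>\<^bsub>?R\<^esub> A"
      by (simp add: mem l_minus)
    also have "\<dots> \<in> compact_ops" using A by (intro left) auto
    finally show "\<ominus>\<^bsub>?R\<^esub> A \<in> compact_ops" .
  next
    show "compact_ops \<subseteq> carrier ?R" unfolding subset_iff mem by simp
    show "compact_ops \<noteq> ({} :: ('v \<Rightarrow> 'v) set)" by (metis zero empty_iff)
  qed (rule plus)
  show "\<And>a x. a \<in> compact_ops \<Longrightarrow> x \<in> carrier ?R \<Longrightarrow> x \<otimes>\<^bsub>?R\<^esub> a \<in> compact_ops" by (rule left)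
  show "\<And>a x. a \<in> compact_ops \<Longrightarrow> x \<in> carrier ?R \<Longrightarrow> a \<otimes>\<^bsub>?R\<^esub> x \<in> compact_ops" by (rule right)
qed

definition calkin :: "('v::right_quat_hilbert \<Rightarrow> 'v) set ring"
  where "calkin = bounded_ops Quot compact_ops"

definition calkin_proj ::
    "('v::right_quat_hilbert \<Rightarrow> 'v) \<Rightarrow> ('v \<Rightarrow> 'v) set"
  where "calkin_proj A = compact_ops +>\<^bsub>bounded_ops\<^esub> A"


section \<open>Finite dimension over the quaternions and Fredholm operators\<close>

(* Right spaces are kept in HOL-Algebra's module record, smult q v standing for v q; its
   fields mult and one play no role.  The locale module is not available here because it
   requires commuting scalars. *)
definition right_space :: "'v::right_quat_vector set \<Rightarrow> (quat, 'v) module"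
  where "right_space W =
    \<lparr>carrier = W, mult = undefined, one = undefined, zero = 0, add = (+),
     smult = (\<lambda>q v. v \<cdot>\<^sub>Q q)\<rparr>"

(* V/W: the cosets of the subspace W; (v + W) q = v q + W. *)
definition right_quotient :: "'v::right_quat_vector set \<Rightarrow> (quat, 'v set) module"
  where "right_quotient W =
    \<lparr>carrier = a_rcosets\<^bsub>right_space UNIV\<^esub> W, mult = undefined, one = undefined,
     zero = W, add = set_add (right_space UNIV),
     smult = (\<lambda>q X. \<Union>v\<in>X. W +>\<^bsub>right_space UNIV\<^esub> (v \<cdot>\<^sub>Q q))\<rparr>"

lemma abelian_group_right_space_UNIV: "abelian_group (right_space (UNIV :: 'v::right_quat_vector set))"
proof (rule abelian_groupI)
  fix x :: 'v assume "x \<in> carrier (right_space UNIV)"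
  show "\<exists>y\<in>carrier (right_space UNIV). y \<oplus>\<^bsub>right_space UNIV\<^esub> x = \<zero>\<^bsub>right_space UNIV\<^esub>"
    by (intro bexI[of _ "- x"]) (simp_all add: right_space_def)
qed (simp_all add: right_space_def add_ac)

lemma right_quotient_smult:
  fixes W :: "'v::right_quat_vector set"
  assumes "0 \<in> W" "\<And>x y. x \<in> W \<Longrightarrow> y \<in> W \<Longrightarrow> x + y \<in> W" "\<And>x q. x \<in> W \<Longrightarrow> x \<cdot>\<^sub>Q q \<in> W"
  shows "q \<odot>\<^bsub>right_quotient W\<^esub> (W +>\<^bsub>right_space UNIV\<^esub> v) = W +>\<^bsub>right_space UNIV\<^esub> (v \<cdot>\<^sub>Q q)"
proof -
  have c: "W +>\<^bsub>right_space UNIV\<^esub> u = {w + u |w. w \<in> W}" for u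
    by (auto simp: a_r_coset_def' right_space_def)
  show ?thesis using assms
    by (auto simp: right_quotient_def c scaleQ_add_left)
qed

definition finite_dim :: "(quat, 'w) module \<Rightarrow> bool"
  where "finite_dim M \<longleftrightarrow> (\<exists>S. finite S \<and> S \<subseteq> carrier M \<and>
    (\<forall>v\<in>carrier M. \<exists>c. v = (\<Oplus>\<^bsub>M\<^esub>s\<in>S. c s \<odot>\<^bsub>M\<^esub> s)))"

definition fredholm :: "('v::right_quat_hilbert \<Rightarrow> 'v) \<Rightarrow> bool"
  where "fredholm A \<longleftrightarrow> bounded_right_linear A \<and>
    finite_dim (right_space {x. A x = 0}) \<and> finite_dim (right_quotient (range A))"

end

theory Submission
  imports Defs
begin

text \<open>Both directions rest on one characterization of invertibility in the Calkin algebra: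
\<open>\<pi>(A)\<close> is a unit iff some bounded right-linear \<open>B\<close> makes \<open>A B - 1\<close> and \<open>B A - 1\<close> compact
(\<open>calkin_proj_Units_iff\<close>).

Suppose such a \<open>B\<close> exists.  A compact operator \<open>K\<close> on a Hilbert space lies within distance
\<open>1/2\<close> of a finite-rank operator \<open>P K\<close>, where \<open>P\<close> is the orthogonal projection onto the span of
the centres of a finite cover of the image of the unit ball by balls of radius \<open>1/2\<close>.  Hence
\<open>1 + K = U + P K\<close>, where \<open>U = 1 + (K - P K)\<close> is bijective by the contraction principle.  With
\<open>K = B A - 1\<close>, every \<open>x\<close> in the kernel of \<open>A\<close> satisfies \<open>U x = - P K x\<close>, so the kernel lies in
the finite-dimensional space \<open>U\<^sup>-\<^sup>1(ran P)\<close>.  With \<open>K = A B - 1\<close>, every vector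
\<open>v = U x = A B x - P K x\<close> lies in the range of \<open>A\<close> modulo \<open>ran P\<close>, so the cokernel is finite
dimensional.

Suppose conversely that \<open>A\<close> is Fredholm.  Let \<open>P\<close> be the orthogonal projection onto the kernel
of \<open>A\<close>, and choose a finite-dimensional algebraic complement \<open>W\<close> of the range.  The map
\<open>(x, w) \<mapsto> A x + w\<close> is a bounded bijection from \<open>ker P \<times> W\<close> onto the whole space, so by
the open mapping theorem its inverse is bounded.  The first component \<open>B\<close> of the inverse satisfies
\<open>B A = 1 - P\<close> and \<open>1 - A B\<close> maps into \<open>W\<close>; both defects have finite rank and are compact.\<close>

section \<open>Right subspaces and finite spans\<close>

definition right_subspace :: "'v::right_quat_vector set \<Rightarrow> bool"
  where "right_subspace W \<longleftrightarrow>
    0 \<in> W \<and> (\<forall>x\<in>W. \<forall>y\<in>W. x + y \<in> W) \<and> (\<forall>x\<in>W. \<forall>q. x \<cdot>\<^sub>Q q \<in> W)"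

text \<open>Intended for finite \<open>S\<close>; an infinite \<open>S\<close> gives \<open>{0}\<close>, by the convention for infinite
sums.\<close>

definition right_span :: "'v::right_quat_vector set \<Rightarrow> 'v set"
  where "right_span S = range (\<lambda>c. \<Sum>s\<in>S. s \<cdot>\<^sub>Q c s)"

lemma scaleQ_zero_left: "0 \<cdot>\<^sub>Q q = (0::'v::right_quat_vector)"
  using scaleQ_add_left[of "0::'v" 0 q] by simp

lemma scaleQ_zero_right: "x \<cdot>\<^sub>Q 0 = (0::'v::right_quat_vector)"
  using scaleQ_add_right[of x 0 0] by simp

lemma scaleQ_minus_left: "(- x) \<cdot>\<^sub>Q q = - (x \<cdot>\<^sub>Q q)" for x :: "'v::right_quat_vector"
  using scaleQ_add_left[of x "-x" q] by (simp add: scaleQ_zero_left eq_neg_iff_add_eq_0 add.commute)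

lemma scaleQ_minus_right: "x \<cdot>\<^sub>Q (- q) = - (x \<cdot>\<^sub>Q q)" for x :: "'v::right_quat_vector"
  using scaleQ_add_right[of x q "-q"] by (simp add: scaleQ_zero_right eq_neg_iff_add_eq_0 add.commute)

lemma scaleQ_diff_left: "(x - y) \<cdot>\<^sub>Q q = x \<cdot>\<^sub>Q q - y \<cdot>\<^sub>Q q" for x :: "'v::right_quat_vector"
  using scaleQ_add_left[of x "-y" q] by (simp add: scaleQ_minus_left)

lemma scaleQ_sum_left: "(\<Sum>i\<in>I. f i) \<cdot>\<^sub>Q q = (\<Sum>i\<in>I. f i \<cdot>\<^sub>Q q)" for f :: "'i \<Rightarrow> 'v::right_quat_vector"
  by (induction I rule: infinite_finite_induct) (auto simp: scaleQ_zero_left scaleQ_add_left)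

lemma right_subspace_add: "right_subspace W \<Longrightarrow> x \<in> W \<Longrightarrow> y \<in> W \<Longrightarrow> x + y \<in> W"
  by (simp add: right_subspace_def)

lemma right_subspace_scale: "right_subspace W \<Longrightarrow> x \<in> W \<Longrightarrow> x \<cdot>\<^sub>Q q \<in> W"
  by (simp add: right_subspace_def)

lemma right_subspace_minus: "right_subspace W \<Longrightarrow> x \<in> W \<Longrightarrow> - x \<in> W"
  by (metis right_subspace_def scaleQ_minus_right scaleQ_one)

lemma right_subspace_diff: "right_subspace W \<Longrightarrow> x \<in> W \<Longrightarrow> y \<in> W \<Longrightarrow> x - y \<in> W"
  using right_subspace_minus[of W y] by (metis diff_conv_add_uminus right_subspace_def)

lemma right_subspace_sum:
  "right_subspace W \<Longrightarrow> (\<And>i. i \<in> I \<Longrightarrow> f i \<in> W) \<Longrightarrow> sum f I \<in> W"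
  by (induction I rule: infinite_finite_induct) (auto simp: right_subspace_def)

lemma right_subspace_right_span: "right_subspace (right_span S)"
proof -
  have "0 = (\<Sum>s\<in>S. s \<cdot>\<^sub>Q 0)" by (simp add: scaleQ_zero_right)
  moreover have "(\<Sum>s\<in>S. s \<cdot>\<^sub>Q c s) + (\<Sum>s\<in>S. s \<cdot>\<^sub>Q d s) = (\<Sum>s\<in>S. s \<cdot>\<^sub>Q (c s + d s))" for c d
    by (simp add: sum.distrib scaleQ_add_right)
  moreover have "(\<Sum>s\<in>S. s \<cdot>\<^sub>Q c s) \<cdot>\<^sub>Q q = (\<Sum>s\<in>S. s \<cdot>\<^sub>Q (c s * q))" for c q
    by (simp add: scaleQ_sum_left scaleQ_scaleQ)
  ultimately show ?thesis
    unfolding right_subspace_def right_span_def by (auto intro!: image_eqI)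
qed

lemma right_span_superset:
  assumes "finite S" "s \<in> S"
  shows "s \<in> right_span S"
proof -
  have "(\<Sum>t\<in>S. t \<cdot>\<^sub>Q (if t = s then 1 else 0)) = (\<Sum>t\<in>S. if t = s then s else 0)"
    by (intro sum.cong) (auto simp: scaleQ_one scaleQ_zero_right)
  also have "\<dots> = s" using assms by simp
  finally show ?thesis
    unfolding right_span_def by (intro range_eqI[of _ _ "\<lambda>t. if t = s then 1 else 0"]) (rule sym)
qed

lemma right_span_minimal:
  assumes "right_subspace W" "S \<subseteq> W"
  shows "right_span S \<subseteq> W"
  using assms unfolding right_span_def
  by (auto intro!: right_subspace_sum) (auto simp: right_subspace_def)

text \<open>This splits off one coefficient and thereby drives every induction over a finite spanning set
below.\<close>

lemma right_span_insert_iff: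
  assumes "finite S"
  shows "v \<in> right_span (insert t S) \<longleftrightarrow> (\<exists>q. v - t \<cdot>\<^sub>Q q \<in> right_span S)"
proof
  assume v: "v \<in> right_span (insert t S)"
  show "\<exists>q. v - t \<cdot>\<^sub>Q q \<in> right_span S"
  proof (cases "t \<in> S")
    case True
    then show ?thesis using v by (intro exI[of _ 0]) (auto simp: insert_absorb scaleQ_zero_right)
  next
    case False
    obtain c where "v = (\<Sum>s\<in>insert t S. s \<cdot>\<^sub>Q c s)" using v by (auto simp: right_span_def)
    then have "v - t \<cdot>\<^sub>Q c t = (\<Sum>s\<in>S. s \<cdot>\<^sub>Q c s)" using False assms by simp
    then show ?thesis unfolding right_span_def by blast
  qed
next
  assume "\<exists>q. v - t \<cdot>\<^sub>Q q \<in> right_span S"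
  then obtain q where q: "v - t \<cdot>\<^sub>Q q \<in> right_span S" ..
  have sub: "right_span S \<subseteq> right_span (insert t S)"
    using assms by (intro right_span_minimal right_subspace_right_span) (auto intro: right_span_superset)
  have "t \<cdot>\<^sub>Q q \<in> right_span (insert t S)"
    using assms right_span_superset[of "insert t S" t] right_subspace_right_span[of "insert t S"]
    by (auto simp: right_subspace_def)
  then have "(v - t \<cdot>\<^sub>Q q) + t \<cdot>\<^sub>Q q \<in> right_span (insert t S)"
    using q sub right_subspace_right_span[of "insert t S"] unfolding right_subspace_def by blast
  then show "v \<in> right_span (insert t S)" by simp
qed

lemma right_span_empty: "right_span {} = {0}"
  by (auto simp: right_span_def)

lemma right_span_image:
  assumes "finite S" "\<And>x y. f (x + y) = f x + f y" "\<And>x q. f (x \<cdot>\<^sub>Q q) = f x \<cdot>\<^sub>Q q"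
    and "x \<in> right_span S"
  shows "f x \<in> right_span (f ` S)"
proof -
  have "f 0 = 0" using assms(2)[of 0 0] by simp
  then have "right_subspace {x. f x \<in> right_span (f ` S)}"
    using right_subspace_right_span[of "f ` S"] by (auto simp: right_subspace_def assms(2,3))
  moreover have "S \<subseteq> {x. f x \<in> right_span (f ` S)}"
    using assms(1) by (auto intro: right_span_superset)
  ultimately show ?thesis using right_span_minimal assms(4) by blast
qed

lemma scaleQ_cancel:
  assumes "q \<noteq> 0"
  shows "(x \<cdot>\<^sub>Q q) \<cdot>\<^sub>Q inverse q = x"
  using assms by (simp add: scaleQ_scaleQ[symmetric] scaleQ_one)

text \<open>A subspace of a finite-dimensional space has a finite spanning set of its own.  Induction on
the ambient spanning set: if \<open>M\<close> contains a vector \<open>m\<close> with nonzero coefficient at the new generator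
\<open>t\<close>, then subtracting a multiple of \<open>m\<close> moves any other vector of \<open>M\<close> into the span of
the old generators, so \<open>m\<close> together with generators of the intersection of \<open>M\<close>
with that span generates \<open>M\<close>.\<close>

lemma right_subspace_finitely_spanned:
  assumes "finite Y" "right_subspace M" "M \<subseteq> right_span Y"
  obtains S where "finite S" "S \<subseteq> M" "M = right_span S"
proof -
  have "\<exists>S. finite S \<and> S \<subseteq> M \<and> M = right_span S"
    using assms
  proof (induction Y arbitrary: M rule: finite_induct)
    case empty
    then have "M = {0}" by (auto simp: right_span_empty right_subspace_def)
    then show ?case by (intro exI[of _ "{}"]) (simp add: right_span_empty)
  next
    case (insert t Y)
    let ?L = "M \<inter> right_span Y"
    have "right_subspace ?L"
      using insert.prems right_subspace_right_span[of Y] by (auto simp: right_subspace_def)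
    then obtain S where S: "finite S" "S \<subseteq> ?L" "?L = right_span S"
      using insert.IH[of ?L] by auto
    show ?case
    proof (cases "M \<subseteq> right_span Y")
      case True
      then show ?thesis using S by (metis inf.absorb1)
    next
      case False
      then obtain m where m: "m \<in> M" "m \<notin> right_span Y" by blast
      then obtain q where q: "m - t \<cdot>\<^sub>Q q \<in> right_span Y"
        using insert.prems right_span_insert_iff[OF insert.hyps(1)] by blast
      have "q \<noteq> 0" using m q by (auto simp: scaleQ_zero_right)
      have "M \<subseteq> right_span (insert m S)"
      proof
        fix x assume x: "x \<in> M"
        then obtain p where p: "x - t \<cdot>\<^sub>Q p \<in> right_span Y"
          using insert.prems right_span_insert_iff[OF insert.hyps(1)] by blast
        define r where "r = inverse q * p"
        have "(m - t \<cdot>\<^sub>Q q) \<cdot>\<^sub>Q r = m \<cdot>\<^sub>Q r - t \<cdot>\<^sub>Q p"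
          using \<open>q \<noteq> 0\<close> by (simp add: r_def scaleQ_diff_left scaleQ_scaleQ scaleQ_cancel)
        moreover have "(m - t \<cdot>\<^sub>Q q) \<cdot>\<^sub>Q r \<in> right_span Y"
          using q right_subspace_right_span[of Y] by (auto simp: right_subspace_def)
        ultimately have "(x - t \<cdot>\<^sub>Q p) - (m \<cdot>\<^sub>Q r - t \<cdot>\<^sub>Q p) \<in> right_span Y"
          using p right_subspace_diff[OF right_subspace_right_span] by metis
        then have "x - m \<cdot>\<^sub>Q r \<in> right_span Y" by simp
        moreover have "x - m \<cdot>\<^sub>Q r \<in> M"
          using x m(1) insert.prems(1)
          by (intro right_subspace_diff) (auto simp: right_subspace_def)
        ultimately show "x \<in> right_span (insert m S)"
          using S right_span_insert_iff[OF S(1)] by blast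
      qed
      moreover have "right_span (insert m S) \<subseteq> M"
        using insert.prems m S by (intro right_span_minimal) auto
      ultimately show ?thesis using S m by (intro exI[of _ "insert m S"]) auto
    qed
  qed
  then show ?thesis using that by blast
qed

text \<open>Discarding each generator that is redundant modulo \<open>M\<close> and the generators kept so far leaves a
span that still represents all classes modulo \<open>M\<close> but meets \<open>M\<close> only in \<open>0\<close>.  For \<open>M\<close> the range
of a Fredholm operator, this gives the algebraic complement.\<close>

lemma finite_complement_modulo:
  assumes "finite T" "right_subspace M"
  obtains T' where "finite T'" "right_span T' \<inter> M = {0}"
    "\<And>v. v \<in> right_span T \<Longrightarrow> \<exists>u\<in>right_span T'. v - u \<in> M"
proof -
  have "\<exists>T'. finite T' \<and> right_span T' \<inter> M = {0} \<and>
      (\<forall>v\<in>right_span T. \<exists>u\<in>right_span T'. v - u \<in> M)"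
    using assms(1)
  proof (induction T rule: finite_induct)
    case empty
    show ?case using assms(2)
      by (intro exI[of _ "{}"]) (auto simp: right_span_empty right_subspace_def)
  next
    case (insert t T)
    then obtain T' where T': "finite T'" "right_span T' \<inter> M = {0}"
      "\<And>v. v \<in> right_span T \<Longrightarrow> \<exists>u\<in>right_span T'. v - u \<in> M" by blast
    note sT' = right_subspace_right_span[of T'] and M = assms(2)
    show ?case
    proof (cases "\<exists>u\<in>right_span T'. t - u \<in> M")
      case True
      then obtain u where u: "u \<in> right_span T'" "t - u \<in> M" by blast
      have "\<exists>u'\<in>right_span T'. v - u' \<in> M" if v: "v \<in> right_span (insert t T)" for v
      proof -
        obtain q where "v - t \<cdot>\<^sub>Q q \<in> right_span T"
          using v right_span_insert_iff[OF insert.hyps(1)] by blast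
        then obtain w where w: "w \<in> right_span T'" "v - t \<cdot>\<^sub>Q q - w \<in> M" using T'(3) by blast
        have "(v - t \<cdot>\<^sub>Q q - w) + (t - u) \<cdot>\<^sub>Q q \<in> M"
          using w u M by (auto simp: right_subspace_def)
        then have "v - (w + u \<cdot>\<^sub>Q q) \<in> M" by (simp add: scaleQ_diff_left algebra_simps)
        moreover have "w + u \<cdot>\<^sub>Q q \<in> right_span T'"
          using w u sT' by (auto simp: right_subspace_def)
        ultimately show ?thesis by blast
      qed
      then show ?thesis using T' by blast
    next
      case False
      have "right_span (insert t T') \<inter> M \<subseteq> {0}"
      proof
        fix v assume v: "v \<in> right_span (insert t T') \<inter> M"
        then obtain q where q: "v - t \<cdot>\<^sub>Q q \<in> right_span T'"
          using right_span_insert_iff[OF T'(1)] by blast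
        have "q = 0"
        proof (rule ccontr)
          assume "q \<noteq> 0"
          let ?u = "- ((v - t \<cdot>\<^sub>Q q) \<cdot>\<^sub>Q inverse q)"
          have "?u = t - v \<cdot>\<^sub>Q inverse q"
            using \<open>q \<noteq> 0\<close> by (simp add: scaleQ_diff_left scaleQ_cancel)
          then have "t - ?u \<in> M" using v M by (auto simp: right_subspace_def)
          moreover have "?u \<in> right_span T'"
            using q sT' by (intro right_subspace_minus) (auto simp: right_subspace_def)
          ultimately show False using False by blast
        qed
        then show "v \<in> {0}" using q v T'(2) by (auto simp: scaleQ_zero_right)
      qed
      moreover have "0 \<in> right_span (insert t T') \<inter> M"
        using M right_subspace_right_span[of "insert t T'"] by (auto simp: right_subspace_def)
      moreover have "\<exists>u\<in>right_span (insert t T'). v - u \<in> M" if v: "v \<in> right_span (insert t T)" for v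
      proof -
        obtain q where "v - t \<cdot>\<^sub>Q q \<in> right_span T"
          using v right_span_insert_iff[OF insert.hyps(1)] by blast
        then obtain w where w: "w \<in> right_span T'" "v - t \<cdot>\<^sub>Q q - w \<in> M" using T'(3) by blast
        have "w + t \<cdot>\<^sub>Q q \<in> right_span (insert t T')"
          using w right_span_insert_iff[OF T'(1), of "w + t \<cdot>\<^sub>Q q" t] by (metis add_diff_cancel_right')
        then show ?thesis using w by (metis diff_diff_eq add.commute)
      qed
      ultimately show ?thesis using T'(1) by (intro exI[of _ "insert t T'"]) blast
    qed
  qed
  then show ?thesis using that by blast
qed

section \<open>Finite-dimensional subspaces and quotients\<close>

lemma finite_dim_right_space_iff:
  assumes W: "right_subspace W"
  shows "finite_dim (right_space W) \<longleftrightarrow> (\<exists>S. finite S \<and> S \<subseteq> W \<and> W = right_span S)"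
proof -
  let ?M = "right_space W"
  have "abelian_group ?M"
  proof (rule abelian_groupI)
    fix x assume "x \<in> carrier ?M"
    then show "\<exists>y\<in>carrier ?M. y \<oplus>\<^bsub>?M\<^esub> x = \<zero>\<^bsub>?M\<^esub>"
      using W right_subspace_minus[of W x] by (intro bexI[of _ "- x"]) (auto simp: right_space_def)
  qed (use W in \<open>auto simp: right_space_def right_subspace_def add_ac\<close>)
  then interpret abelian_group ?M .
  have fs: "(\<Oplus>\<^bsub>?M\<^esub>s\<in>S. c s \<odot>\<^bsub>?M\<^esub> s) = (\<Sum>s\<in>S. s \<cdot>\<^sub>Q c s)"
    if "finite S" "S \<subseteq> W" for S c
    using that
  proof (induction S rule: finite_induct)
    case empty
    then show ?case by simp (simp add: right_space_def)
  next
    case (insert t S)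
    have "(\<lambda>s. c s \<odot>\<^bsub>?M\<^esub> s) \<in> insert t S \<rightarrow> carrier ?M"
      using insert.prems W by (auto simp: right_space_def right_subspace_def)
    then show ?case using insert by (simp add: finsum_insert Pi_iff) (simp add: right_space_def)
  qed
  have "(\<forall>v\<in>W. \<exists>c. v = (\<Oplus>\<^bsub>?M\<^esub>s\<in>S. c s \<odot>\<^bsub>?M\<^esub> s)) \<longleftrightarrow> W = right_span S"
    if "finite S" "S \<subseteq> W" for S
    using right_span_minimal[OF W that(2)] by (auto simp: fs[OF that] right_span_def image_def)
  moreover have "carrier ?M = W" by (simp add: right_space_def)
  ultimately show ?thesis unfolding finite_dim_def by metis
qed

text \<open>The coefficients in the quotient are indexed by cosets, not by representatives.  From left to
right, choose one representative per coset.  From right to left, two generators may lie in the same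
coset; replacing them by a system from \<open>finite_complement_modulo\<close> makes the coset map injective on
generators, and coefficients can then be transported.\<close>

lemma finite_dim_right_quotient_iff:
  fixes W :: "'v::right_quat_vector set"
  assumes W: "right_subspace W"
  shows "finite_dim (right_quotient W) \<longleftrightarrow>
    (\<exists>T. finite T \<and> (\<forall>v. \<exists>u\<in>right_span T. v - u \<in> W))"
proof -
  let ?G = "right_space (UNIV :: 'v set)" and ?Q = "right_quotient W"
  interpret G: abelian_group ?G by (rule abelian_group_right_space_UNIV)
  have simps: "carrier ?G = UNIV" "x \<oplus>\<^bsub>?G\<^esub> y = x + y" "\<zero>\<^bsub>?G\<^esub> = 0" for x y
    by (simp_all add: right_space_def)
  have neg: "\<ominus>\<^bsub>?G\<^esub> x = - x" for x
    by (rule G.minus_equality) (auto simp: simps)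
  have "additive_subgroup W ?G"
    using W right_subspace_minus[OF W] neg
    by (intro additive_subgroup.intro G.add.subgroupI) (auto simp: simps right_subspace_def a_inv_def)
  then interpret abelian_subgroup W ?G
    by (rule abelian_subgroupI3) (rule abelian_group_right_space_UNIV)
  define cl where "cl v = W +>\<^bsub>?G\<^esub> v" for v
  have cl: "cl v = {w + v | w. w \<in> W}" for v
    by (auto simp: cl_def a_r_coset_def' simps)
  have cl_eq: "cl u = cl v \<longleftrightarrow> u - v \<in> W" for u v
  proof
    assume "cl u = cl v"
    moreover have "u \<in> cl u" using W by (auto simp: cl right_subspace_def intro!: exI[of _ 0])
    ultimately show "u - v \<in> W" by (auto simp: cl)
  next
    assume uv: "u - v \<in> W"
    have "w + u = (w + (u - v)) + v" "w + v = (w - (u - v)) + u" for w by simp_all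
    moreover have "w + (u - v) \<in> W" "w - (u - v) \<in> W" if "w \<in> W" for w
      using uv that W right_subspace_diff[OF W] by (auto simp: right_subspace_def)
    ultimately show "cl u = cl v" unfolding cl by blast
  qed
  have carr: "carrier ?Q = range cl"
    by (auto simp: right_quotient_def cl_def A_RCOSETS_def' simps)
  have add: "cl u \<oplus>\<^bsub>?Q\<^esub> cl v = cl (u + v)" for u v
    using a_rcos_sum[of u v] by (simp add: right_quotient_def cl_def simps)
  have smult: "q \<odot>\<^bsub>?Q\<^esub> cl v = cl (v \<cdot>\<^sub>Q q)" for q v
    unfolding cl_def using W by (intro right_quotient_smult) (auto simp: right_subspace_def)
  have zero: "\<zero>\<^bsub>?Q\<^esub> = cl 0"
    by (auto simp: right_quotient_def cl)
  have "abelian_group ?Q"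
  proof (rule abelian_groupI)
    fix x assume "x \<in> carrier ?Q"
    then obtain v where "x = cl v" by (auto simp: carr)
    then show "\<exists>y\<in>carrier ?Q. y \<oplus>\<^bsub>?Q\<^esub> x = \<zero>\<^bsub>?Q\<^esub>"
      by (intro bexI[of _ "cl (- v)"]) (auto simp: carr add zero)
  qed (auto simp: carr add zero add_ac)
  then interpret Q: abelian_group ?Q .
  have fs: "(\<Oplus>\<^bsub>?Q\<^esub>X\<in>cl ` T. c X \<odot>\<^bsub>?Q\<^esub> X) = cl (\<Sum>t\<in>T. t \<cdot>\<^sub>Q c (cl t))"
    if "finite T" "inj_on cl T" for T c
    using that
  proof (induction T rule: finite_induct)
    case empty
    then show ?case by (simp add: zero)
  next
    case (insert t T)
    have "(\<lambda>X. c X \<odot>\<^bsub>?Q\<^esub> X) \<in> insert (cl t) (cl ` T) \<rightarrow> carrier ?Q"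
      by (auto simp: carr smult)
    then show ?case using insert by (simp add: Q.finsum_insert Pi_iff smult add)
  qed
  show ?thesis
  proof
    assume "finite_dim ?Q"
    then obtain S where S: "finite S" "S \<subseteq> range cl"
      "\<forall>Y\<in>range cl. \<exists>c. Y = (\<Oplus>\<^bsub>?Q\<^esub>X\<in>S. c X \<odot>\<^bsub>?Q\<^esub> X)"
      unfolding finite_dim_def carr by (elim exE conjE) (rule that)
    obtain T where T: "inj_on cl T" "S = cl ` T"
      using S(2) unfolding subset_image_inj by blast
    then have "finite T" using S(1) finite_imageD by blast
    note T = T this
    have "\<exists>u\<in>right_span T. v - u \<in> W" for v
    proof -
      obtain c where "cl v = cl (\<Sum>t\<in>T. t \<cdot>\<^sub>Q c (cl t))"
        using bspec[OF S(3) rangeI[of cl v]] unfolding T(2) fs[OF T(3,1)] by (elim exE) (rule that)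
      then have "v - (\<Sum>t\<in>T. t \<cdot>\<^sub>Q c (cl t)) \<in> W" by (simp add: cl_eq)
      then show ?thesis by (auto simp: right_span_def)
    qed
    then show "\<exists>T. finite T \<and> (\<forall>v. \<exists>u\<in>right_span T. v - u \<in> W)" using T(3) by blast
  next
    assume "\<exists>T. finite T \<and> (\<forall>v. \<exists>u\<in>right_span T. v - u \<in> W)"
    then obtain T0 where T0: "finite T0" "\<And>v. \<exists>u\<in>right_span T0. v - u \<in> W" by blast
    obtain T where T: "finite T" "right_span T \<inter> W = {0}"
      "\<And>v. v \<in> right_span T0 \<Longrightarrow> \<exists>u\<in>right_span T. v - u \<in> W"
      using finite_complement_modulo[OF T0(1) W] by blast
    have inj: "inj_on cl T"
    proof (rule inj_onI)
      fix s t assume st: "s \<in> T" "t \<in> T" "cl s = cl t"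
      have "s - t \<in> right_span T"
        using st T(1) by (intro right_subspace_diff right_subspace_right_span right_span_superset)
      moreover have "s - t \<in> W" using st(3) unfolding cl_eq .
      ultimately have "s - t \<in> {0}" unfolding T(2)[symmetric] by (rule IntI)
      then show "s = t" by simp
    qed
    have "\<exists>c. cl v = (\<Oplus>\<^bsub>?Q\<^esub>X\<in>cl ` T. c X \<odot>\<^bsub>?Q\<^esub> X)" for v
    proof -
      obtain u0 where u0: "u0 \<in> right_span T0" "v - u0 \<in> W" using T0(2) by blast
      obtain u where u: "u \<in> right_span T" "u0 - u \<in> W" using T(3)[OF u0(1)] by blast
      obtain c where c: "u = (\<Sum>t\<in>T. t \<cdot>\<^sub>Q c t)" using u(1) by (auto simp: right_span_def)
      have "(v - u0) + (u0 - u) \<in> W" using u u0 W unfolding right_subspace_def by blast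
      then have "cl v = cl u" by (simp add: cl_eq)
      also have "u = (\<Sum>t\<in>T. t \<cdot>\<^sub>Q c (the_inv_into T cl (cl t)))"
        unfolding c by (intro sum.cong) (auto simp: the_inv_into_f_f[OF inj])
      also have "cl \<dots> = (\<Oplus>\<^bsub>?Q\<^esub>X\<in>cl ` T. c (the_inv_into T cl X) \<odot>\<^bsub>?Q\<^esub> X)"
        by (rule fs[OF T(1) inj, symmetric])
      finally show ?thesis by (rule exI[of _ "\<lambda>X. c (the_inv_into T cl X)"])
    qed
    then show "finite_dim ?Q"
      unfolding finite_dim_def carr using T(1) by (intro exI[of _ "cl ` T"]) auto
  qed
qed

section \<open>Orthogonality and bounded right-linear operators\<close>

lemma q_cnj_add: "q_cnj (p + q) = q_cnj p + q_cnj q"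
  by (simp add: q_cnj_def quat_defs)

lemma q_cnj_zero: "q_cnj 0 = 0"
  by (simp add: q_cnj_def quat_defs)

lemma of_real_quat_commute: "of_real r * q = q * of_real r" for q :: quat
  by (simp add: of_real_def)

lemma qinner_add_left: "qinner (x + y) z = qinner x z + qinner y z" for x :: "'v::right_quat_inner"
  by (metis q_cnj_add qinner_add_right qinner_cnj)

lemma qinner_zero_right: "qinner x 0 = 0" for x :: "'v::right_quat_inner"
  using qinner_add_right[of x 0 0] by simp

lemma qinner_zero_left: "qinner 0 x = 0" for x :: "'v::right_quat_inner"
  using qinner_add_left[of 0 0 x] by simp

lemma qinner_diff_right: "qinner x (y - z) = qinner x y - qinner x z" for x :: "'v::right_quat_inner"
  using qinner_add_right[of x "y - z" z] by (simp add: eq_diff_eq)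

lemma qinner_eq_0_commute: "qinner x y = 0 \<longleftrightarrow> qinner y x = 0" for x :: "'v::right_quat_inner"
  by (metis q_cnj_zero qinner_cnj)

lemma norm_scaleQ_squared: "(norm (x \<cdot>\<^sub>Q q))\<^sup>2 = (norm x)\<^sup>2 * q_normsq q" for x :: "'v::right_quat_inner"
proof -
  have "of_real ((norm (x \<cdot>\<^sub>Q q))\<^sup>2) = q_cnj q * (of_real ((norm x)\<^sup>2) * q)"
    by (metis qinner_self qinner_scaleQ_left qinner_scaleQ_right)
  also have "\<dots> = of_real ((norm x)\<^sup>2) * (q_cnj q * q)"
    by (simp add: of_real_def)
  also have "\<dots> = of_real ((norm x)\<^sup>2 * q_normsq q)"
    by (simp add: mult_q_cnj)
  finally show ?thesis by (metis of_real_eq_iff)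
qed

lemma norm_add_squared_orthogonal:
  fixes x :: "'v::right_quat_inner"
  assumes "qinner x y = 0"
  shows "(norm (x + y))\<^sup>2 = (norm x)\<^sup>2 + (norm y)\<^sup>2"
proof -
  have "of_real ((norm (x + y))\<^sup>2) = qinner (x + y) (x + y)" by (simp add: qinner_self)
  also have "\<dots> = qinner x x + qinner y y"
    using assms qinner_eq_0_commute[of x y] by (simp add: qinner_add_left qinner_add_right)
  also have "\<dots> = of_real ((norm x)\<^sup>2 + (norm y)\<^sup>2)" by (simp add: qinner_self)
  finally show ?thesis by (metis of_real_eq_iff)
qed

lemma norm_le_of_orthogonal:
  fixes x :: "'v::right_quat_inner"
  assumes "qinner x y = 0"
  shows "norm x \<le> norm (x + y)" "norm y \<le> norm (x + y)"
  using norm_add_squared_orthogonal[OF assms] by (auto intro: power2_le_imp_le)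

text \<open>Real homogeneity is the case of a real quaternion in the second premise.\<close>

lemma bounded_right_linearI:
  fixes A :: "'v::right_quat_hilbert \<Rightarrow> 'v"
  assumes "\<And>x y. A (x + y) = A x + A y" "\<And>x q. A (x \<cdot>\<^sub>Q q) = A x \<cdot>\<^sub>Q q"
    and "\<And>x. norm (A x) \<le> norm x * K"
  shows "bounded_right_linear A"
  unfolding bounded_right_linear_def
  by (intro conjI bounded_linear_intro[where K = K]) (auto simp: scaleR_scaleQ assms)

lemma bounded_right_linear_id: "bounded_right_linear (\<lambda>x. x)"
  by (simp add: bounded_right_linear_def bounded_linear_ident)

lemma bounded_right_linear_diff:
  assumes "bounded_right_linear A" "bounded_right_linear B"
  shows "bounded_right_linear (\<lambda>x. A x - B x)"
  using assms by (auto simp: bounded_right_linear_def bounded_linear_sub scaleQ_diff_left)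

lemma bounded_right_linear_compose:
  assumes "bounded_right_linear A" "bounded_right_linear B"
  shows "bounded_right_linear (\<lambda>x. A (B x))"
  using assms by (auto simp: bounded_right_linear_def bounded_linear_compose)

lemma bounded_right_linear_simps:
  assumes "bounded_right_linear A"
  shows "A (x + y) = A x + A y" "A (x - y) = A x - A y" "A (- x) = - A x" "A 0 = 0"
    "A (x \<cdot>\<^sub>Q q) = A x \<cdot>\<^sub>Q q"
  using assms by (auto simp: bounded_right_linear_def intro: linear_simps)

lemma compact_ops_bounded_right_linear: "K \<in> compact_ops \<Longrightarrow> bounded_right_linear K"
  by (simp add: compact_ops_def)

lemma compact_ops_add:
  assumes "K \<in> compact_ops" "L \<in> compact_ops"
  shows "(\<lambda>x. K x + L x) \<in> compact_ops"
  using additive_subgroup.a_closed[OF ideal.axioms(1)[OF ideal_compact_ops] assms]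
  by (simp add: bounded_ops_def)

lemma compact_ops_compose_left:
  assumes "K \<in> compact_ops" "bounded_right_linear B"
  shows "(\<lambda>x. B (K x)) \<in> compact_ops"
  using ideal.I_l_closed[OF ideal_compact_ops assms(1), of B] assms(2)
  by (simp add: bounded_ops_def o_def)

lemma compact_ops_compose_right:
  assumes "K \<in> compact_ops" "bounded_right_linear B"
  shows "(\<lambda>x. K (B x)) \<in> compact_ops"
  using ideal.I_r_closed[OF ideal_compact_ops assms(1), of B] assms(2)
  by (simp add: bounded_ops_def o_def)

lemma compact_ops_uminus:
  assumes "K \<in> compact_ops"
  shows "(\<lambda>x. - K x) \<in> compact_ops"
proof -
  have "bounded_right_linear (\<lambda>x :: 'a. 0 - x)"
    using bounded_right_linear_diff[OF
        bounded_right_linear_diff[OF bounded_right_linear_id bounded_right_linear_id]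
        bounded_right_linear_id]
    by simp
  then show ?thesis using compact_ops_compose_left[OF assms] by simp
qed

section \<open>Finite-rank projections and approximation of compact operators\<close>

lemma quat_decomposition:
  "q = of_real (q_re q) + of_real (q_i q) * Quat 0 1 0 0
     + of_real (q_j q) * Quat 0 0 1 0 + of_real (q_k q) * Quat 0 0 0 1"
  by (cases q) (simp add: of_real_def quat_defs)

text \<open>The map \<open>x \<mapsto> u \<langle>u|x\<rangle> / \<parallel>u\<parallel>\<^sup>2\<close> is the orthogonal projection onto the line
spanned by \<open>u\<close>.  Its contractivity is Pythagoras' theorem.  For \<open>u = 0\<close> the inverse is \<open>0\<close> by convention and the map vanishes.\<close>

lemma norm_projection_le:
  fixes u :: "'v::right_quat_inner"
  shows "norm (u \<cdot>\<^sub>Q (of_real (inverse ((norm u)\<^sup>2)) * qinner u x)) \<le> norm x" (is "norm ?y \<le> _")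
    and "qinner u (x - u \<cdot>\<^sub>Q (of_real (inverse ((norm u)\<^sup>2)) * qinner u x)) = 0"
proof -
  show 0: "qinner u (x - ?y) = 0"
  proof (cases "u = 0")
    case False
    then have "of_real ((norm u)\<^sup>2) * of_real (inverse ((norm u)\<^sup>2)) = (1 :: quat)"
      by (simp only: of_real_mult[symmetric]) simp
    then show ?thesis
      by (simp only: qinner_diff_right qinner_scaleQ_right qinner_self mult.assoc[symmetric]) simp
  qed (simp add: qinner_zero_left)
  then have "qinner ?y (x - ?y) = 0" by (simp add: qinner_scaleQ_left)
  from norm_le_of_orthogonal(1)[OF this] show "norm ?y \<le> norm x" by simp
qed

lemma compact_closure_of_subset:
  fixes T :: "'a::metric_space set"
  assumes "compact T" "S \<subseteq> T"
  shows "compact (closure S)"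
proof -
  have "closure S \<subseteq> T" using assms by (intro closure_minimal compact_imp_closed)
  then show ?thesis using closed_Int_compact[OF closed_closure assms(1), of S] by (simp add: Int_absorb2)
qed

text \<open>The image of the unit ball consists of vectors \<open>u q\<close> with \<open>|q| \<le> 1 / \<parallel>u\<parallel>\<close>; it lies in
the continuous image of a four-dimensional real cube, one coordinate for each component of \<open>q\<close>.\<close>

lemma rank_one_projection_compact:
  fixes u :: "'v::right_quat_hilbert"
  shows "(\<lambda>x. u \<cdot>\<^sub>Q (of_real (inverse ((norm u)\<^sup>2)) * qinner u x)) \<in> compact_ops" (is "?E \<in> _")
proof -
  have L: "bounded_right_linear ?E"
  proof (rule bounded_right_linearI)
    show "norm (?E x) \<le> norm x * 1" for x using norm_projection_le(1)[of u x] by simp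
  qed (simp_all add: qinner_add_right qinner_scaleQ_right distrib_left scaleQ_add_right
      scaleQ_scaleQ[symmetric] mult.assoc)
  define k where "k = inverse (norm u)"
  let ?f = "\<lambda>(a, b, c, d). a *\<^sub>R u + b *\<^sub>R (u \<cdot>\<^sub>Q Quat 0 1 0 0)
      + c *\<^sub>R (u \<cdot>\<^sub>Q Quat 0 0 1 0) + d *\<^sub>R (u \<cdot>\<^sub>Q Quat 0 0 0 1)"
  let ?T = "?f ` ({-k..k} \<times> {-k..k} \<times> {-k..k} \<times> {-k..k})"
  have "compact ?T"
    by (intro compact_continuous_image compact_Times compact_Icc)
      (auto simp: case_prod_unfold intro!: continuous_intros)
  moreover have "?E ` cball 0 1 \<subseteq> ?T"
  proof
    fix y assume "y \<in> ?E ` cball 0 1"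
    then obtain x where x: "norm x \<le> 1" "y = ?E x" by auto
    define q where "q = of_real (inverse ((norm u)\<^sup>2)) * qinner u x"
    have y: "y = u \<cdot>\<^sub>Q q" using x by (simp add: q_def)
    have "norm y \<le> 1" using norm_projection_le(1)[of u x] x by simp
    have q: "q_normsq q \<le> k\<^sup>2"
    proof (cases "u = 0")
      case True
      then show ?thesis by (simp add: q_def k_def q_normsq_eq_0_iff[THEN iffD2] qinner_zero_left)
    next
      case False
      have "(norm u)\<^sup>2 * q_normsq q \<le> 1"
        using \<open>norm y \<le> 1\<close> unfolding norm_scaleQ_squared[symmetric] y[symmetric]
        by (simp add: power_le_one)
      then show ?thesis using False by (simp add: k_def field_simps)
    qed
    have "k \<ge> 0" by (simp add: k_def)
    have comp: "r \<in> {-k..k}" if "r\<^sup>2 \<le> q_normsq q" for r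
      using order_trans[OF that q] \<open>k \<ge> 0\<close> abs_le_square_iff[of r k] by auto
    have "q_re q \<in> {-k..k}" "q_i q \<in> {-k..k}" "q_j q \<in> {-k..k}" "q_k q \<in> {-k..k}"
      by (rule comp, simp add: q_normsq_def)+
    moreover have "y = ?f (q_re q, q_i q, q_j q, q_k q)"
      unfolding y
      by (subst quat_decomposition)
        (simp add: scaleQ_add_right scaleR_scaleQ scaleQ_scaleQ[symmetric] of_real_quat_commute)
    ultimately show "y \<in> ?T" by blast
  qed
  ultimately have "compact (closure (?E ` cball 0 1))" by (intro compact_closure_of_subset)
  with L show ?thesis unfolding compact_ops_def by blast
qed

text \<open>Gram-Schmidt without normalization: if \<open>P\<close> projects onto the span of \<open>S\<close>, then adding the
projection onto the line of \<open>u = t - P t\<close> gives the projection onto the span of \<open>insert t S\<close>.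
A redundant \<open>t\<close> gives \<open>u = 0\<close> and leaves \<open>P\<close> unchanged.  Compactness comes along because each step
adds a rank-one operator.\<close>

lemma compact_projection_right_span:
  fixes S :: "'v::right_quat_hilbert set"
  assumes "finite S"
  obtains P where "P \<in> compact_ops" "\<And>x. P x \<in> right_span S"
    "\<And>x. x \<in> right_span S \<Longrightarrow> P x = x" "\<And>x. norm (x - P x) \<le> norm x"
proof -
  have "\<exists>P \<in> compact_ops. (\<forall>x. P x \<in> right_span S) \<and>
      (\<forall>w\<in>right_span S. \<forall>x. qinner w (x - P x) = 0)"
    using assms
  proof (induction S rule: finite_induct)
    case empty
    have "(\<lambda>x. 0) \<in> (compact_ops :: ('v \<Rightarrow> 'v) set)"
      using rank_one_projection_compact[of 0] by (simp add: scaleQ_zero_left)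
    then show ?case
      by (intro bexI[of _ "\<lambda>x. 0"]) (auto simp: right_span_empty qinner_zero_left)
  next
    case (insert t S)
    then obtain P where P: "P \<in> compact_ops" "\<And>x. P x \<in> right_span S"
      "\<And>w x. w \<in> right_span S \<Longrightarrow> qinner w (x - P x) = 0" by blast
    define u where "u = t - P t"
    define E where "E x = u \<cdot>\<^sub>Q (of_real (inverse ((norm u)\<^sup>2)) * qinner u x)" for x
    have E: "E \<in> compact_ops" unfolding E_def[abs_def] by (rule rank_one_projection_compact)
    have wu: "qinner w u = 0" if "w \<in> right_span S" for w
      unfolding u_def by (rule P(3)[OF that])
    have wE: "qinner w (E x) = 0" if "w \<in> right_span S" for w x
      using wu[OF that] by (simp add: E_def qinner_scaleQ_right)
    have uE: "qinner u (x - (P x + E x)) = 0" for x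
    proof -
      have "qinner u (P x) = 0" using wu[OF P(2)] qinner_eq_0_commute by blast
      then show ?thesis
        using norm_projection_le(2)[of u x] by (simp add: E_def qinner_diff_right qinner_add_right)
    qed
    have Pt: "t - u \<in> right_span S" using P(2) by (simp add: u_def)
    have "P x + E x \<in> right_span (insert t S)" for x
    proof -
      define q where "q = of_real (inverse ((norm u)\<^sup>2)) * qinner u x"
      have "P x + E x - t \<cdot>\<^sub>Q q = P x - (t - u) \<cdot>\<^sub>Q q"
        by (simp add: E_def q_def scaleQ_diff_left)
      also have "\<dots> \<in> right_span S"
        using P(2) Pt right_subspace_right_span[of S]
        by (intro right_subspace_diff) (auto simp: right_subspace_def)
      finally show ?thesis using right_span_insert_iff[OF insert.hyps(1)] by blast
    qed
    moreover have "qinner w (x - (P x + E x)) = 0" if w_in: "w \<in> right_span (insert t S)" for w x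
    proof -
      obtain q where "w - t \<cdot>\<^sub>Q q \<in> right_span S"
        using w_in unfolding right_span_insert_iff[OF insert.hyps(1)] by blast
      then have "(w - t \<cdot>\<^sub>Q q) + (t - u) \<cdot>\<^sub>Q q \<in> right_span S"
        by (intro right_subspace_add right_subspace_scale right_subspace_right_span Pt)
      then have w: "w - u \<cdot>\<^sub>Q q \<in> right_span S" by (simp add: scaleQ_diff_left)
      have "qinner w (x - (P x + E x)) =
          qinner (w - u \<cdot>\<^sub>Q q) ((x - P x) - E x) + qinner (u \<cdot>\<^sub>Q q) (x - (P x + E x))"
        by (simp add: qinner_add_left[symmetric] diff_diff_eq)
      also have "\<dots> = 0"
        using P(3)[OF w, of x] wE[OF w, of x] uE[of x]
        by (simp add: qinner_diff_right qinner_scaleQ_left)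
      finally show ?thesis .
    qed
    moreover have "(\<lambda>x. P x + E x) \<in> compact_ops" by (rule compact_ops_add[OF P(1) E])
    ultimately show ?case by (intro bexI[of _ "\<lambda>x. P x + E x"]) auto
  qed
  then obtain P where P: "P \<in> compact_ops" "\<And>x. P x \<in> right_span S"
    "\<And>w x. w \<in> right_span S \<Longrightarrow> qinner w (x - P x) = 0" by blast
  have "P x = x" if "x \<in> right_span S" for x
  proof -
    have "qinner (x - P x) (x - P x) = 0"
      using P(2) that by (intro P(3) right_subspace_diff right_subspace_right_span)
    then show ?thesis by (simp add: qinner_self)
  qed
  moreover have "norm (x - P x) \<le> norm x" for x
    using norm_le_of_orthogonal(2)[OF P(3)[OF P(2)], of x x] by simp
  ultimately show ?thesis using P that by blast
qed

text \<open>Cover the image of the unit ball by balls of radius \<open>1/2\<close> around finitely many centres and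
project onto their span: \<open>1 - P\<close> kills the centres and is a contraction, so it maps each of these
balls into the ball of radius \<open>1/2\<close> around \<open>0\<close>.\<close>

lemma compact_operator_approximation:
  fixes K :: "'v::right_quat_hilbert \<Rightarrow> 'v"
  assumes "K \<in> compact_ops"
  obtains Y P where "finite Y" "bounded_right_linear P" "\<And>x. P x \<in> right_span Y"
    "\<And>x. norm (K x - P (K x)) \<le> norm x / 2"
proof -
  have "compact (closure (K ` cball 0 1))" using assms by (simp add: compact_ops_def)
  then obtain Y where Y: "finite Y" "closure (K ` cball 0 1) \<subseteq> (\<Union>y\<in>Y. ball y (1/2))"
    unfolding compact_eq_totally_bounded by (elim conjE allE[of _ "1/2"]) auto
  obtain P where P: "P \<in> compact_ops" "\<And>x. P x \<in> right_span Y"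
    "\<And>x. x \<in> right_span Y \<Longrightarrow> P x = x" "\<And>x. norm (x - P x) \<le> norm x"
    by (rule compact_projection_right_span[OF Y(1)]) (rule that)
  note PL = compact_ops_bounded_right_linear[OF P(1)]
  have unit: "norm (K x - P (K x)) \<le> 1/2" if "norm x \<le> 1" for x
  proof -
    have "K x \<in> closure (K ` cball 0 1)" using that by (intro subsetD[OF closure_subset]) auto
    then obtain y where y: "y \<in> Y" "dist y (K x) < 1/2" using Y(2) by auto
    have "K x - P (K x) = (K x - y) - P (K x - y)"
      using P(3)[OF right_span_superset[OF Y(1) y(1)]] by (simp add: bounded_right_linear_simps[OF PL])
    then have "norm (K x - P (K x)) \<le> norm (K x - y)" using P(4)[of "K x - y"] by (rule ssubst)
    then show ?thesis using y(2) by (simp add: dist_norm norm_minus_commute)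
  qed
  interpret K: bounded_linear K
    using assms by (simp add: compact_ops_def bounded_right_linear_def)
  interpret P: bounded_linear P using PL by (simp add: bounded_right_linear_def)
  have "norm (K x - P (K x)) \<le> norm x / 2" for x
  proof (cases "x = 0")
    case False
    let ?e = "inverse (norm x) *\<^sub>R x"
    have "K x - P (K x) = norm x *\<^sub>R (K ?e - P (K ?e))"
      using False by (simp add: K.scaleR P.scaleR scaleR_diff_right)
    then have "norm (K x - P (K x)) = norm x * norm (K ?e - P (K ?e))" by simp
    also have "\<dots> \<le> norm x * (1/2)" using unit[of ?e] False by (intro mult_left_mono) auto
    finally show ?thesis by simp
  qed (simp add: K.zero P.zero)
  then show ?thesis using that Y(1) PL P(2) by blast
qed

text \<open>Solving \<open>x + E x = y\<close> means finding the fixed point of the contraction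
\<open>x \<mapsto> y - E x\<close>; linearity of the solution map follows from uniqueness.\<close>

lemma identity_plus_contraction_inverse:
  fixes E :: "'v::right_quat_hilbert \<Rightarrow> 'v"
  assumes E: "bounded_right_linear E" "\<And>x. norm (E x) \<le> norm x / 2"
  obtains V where "\<And>x y. V (x + y) = V x + V y" "\<And>x q. V (x \<cdot>\<^sub>Q q) = V x \<cdot>\<^sub>Q q"
    "\<And>y. V y + E (V y) = y" "\<And>x. V (x + E x) = x"
proof -
  note L = bounded_right_linear_simps[OF E(1)]
  have "\<exists>!x. y - E x = x" for y
  proof (rule banach_fix_type[of "1/2"])
    have "dist (y - E x) (y - E x') = norm (E (x - x'))" for x x'
      unfolding dist_norm by (subst norm_minus_cancel[symmetric]) (simp add: L)
    then show "\<forall>x x'. dist (y - E x) (y - E x') \<le> 1/2 * dist x x'"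
      using E(2) by (simp add: dist_norm)
  qed auto
  moreover have "y - E x = x \<longleftrightarrow> x + E x = y" for x y by (auto simp: diff_eq_eq)
  ultimately have ex: "\<exists>!x. x + E x = y" for y by simp
  define V where "V y = (THE x. x + E x = y)" for y
  have V: "V y + E (V y) = y" for y unfolding V_def by (rule theI'[OF ex])
  have Veq: "V y = x" if "x + E x = y" for x y using ex that V by blast
  show ?thesis
  proof (rule that[of V])
    show "V (x + y) = V x + V y" for x y
    proof (rule Veq)
      have "(V x + V y) + E (V x + V y) = (V x + E (V x)) + (V y + E (V y))"
        by (simp add: L algebra_simps)
      then show "(V x + V y) + E (V x + V y) = x + y" by (simp add: V)
    qed
    show "V (x \<cdot>\<^sub>Q q) = V x \<cdot>\<^sub>Q q" for x q
      by (intro Veq) (simp add: L scaleQ_add_left[symmetric] V)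
  qed (auto simp: V Veq)
qed

section \<open>Units of the Calkin algebra\<close>

lemma calkin_proj_Units_iff:
  fixes A :: "'v::right_quat_hilbert \<Rightarrow> 'v"
  assumes A: "bounded_right_linear A"
  shows "calkin_proj A \<in> Units (calkin :: ('v \<Rightarrow> 'v) set ring) \<longleftrightarrow>
    (\<exists>B. bounded_right_linear B \<and> (\<lambda>x. A (B x) - x) \<in> compact_ops \<and> (\<lambda>x. B (A x) - x) \<in> compact_ops)"
proof -
  let ?R = "bounded_ops :: ('v \<Rightarrow> 'v) ring"
  interpret R: ring ?R by (rule ring_bounded_ops)
  interpret I: ideal "compact_ops :: ('v \<Rightarrow> 'v) set" ?R by (rule ideal_compact_ops)
  have simps: "carrier ?R = {B. bounded_right_linear B}" "\<one>\<^bsub>?R\<^esub> = (\<lambda>x. x)"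
    "B \<otimes>\<^bsub>?R\<^esub> D = (\<lambda>x. B (D x))" for B D
    by (auto simp: bounded_ops_def o_def)
  have minus: "B \<ominus>\<^bsub>?R\<^esub> D = (\<lambda>x. B x - D x)" if "bounded_right_linear D" for B D
  proof -
    have "bounded_right_linear (\<lambda>x. - D x)"
      using bounded_right_linear_diff[OF bounded_right_linear_diff[OF that that] that] by simp
    then have "\<ominus>\<^bsub>?R\<^esub> D = (\<lambda>x. - D x)"
      using that by (intro R.minus_equality) (auto simp: bounded_ops_def)
    then show ?thesis by (simp add: a_minus_def) (simp add: bounded_ops_def)
  qed
  have carrier: "carrier (calkin :: ('v \<Rightarrow> 'v) set ring) = calkin_proj ` {B. bounded_right_linear B}"
    by (auto simp: calkin_def calkin_proj_def FactRing_def A_RCOSETS_def' simps)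
  have mult: "calkin_proj B \<otimes>\<^bsub>calkin\<^esub> calkin_proj D = calkin_proj (\<lambda>x. B (D x))"
    if "bounded_right_linear B" "bounded_right_linear D" for B D :: "'v \<Rightarrow> 'v"
    using I.rcoset_mult_add[of B D] that
    by (simp add: calkin_def calkin_proj_def FactRing_def simps)
  have one: "\<one>\<^bsub>calkin\<^esub> = calkin_proj (\<lambda>x :: 'v. x)"
    by (simp add: calkin_def calkin_proj_def FactRing_def simps)
  have eq: "calkin_proj B = calkin_proj (\<lambda>x :: 'v. x) \<longleftrightarrow> (\<lambda>x. B x - x) \<in> compact_ops"
    if "bounded_right_linear B" for B :: "'v \<Rightarrow> 'v"
    using R.quotient_eq_iff_same_a_r_cos[OF ideal_compact_ops, of B "\<lambda>x. x"] that
      minus[OF bounded_right_linear_id]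
    by (simp add: calkin_proj_def simps bounded_right_linear_id)
  have inverse: "calkin_proj B \<otimes>\<^bsub>calkin\<^esub> calkin_proj A = \<one>\<^bsub>calkin\<^esub> \<and>
      calkin_proj A \<otimes>\<^bsub>calkin\<^esub> calkin_proj B = \<one>\<^bsub>calkin\<^esub> \<longleftrightarrow>
      (\<lambda>x. A (B x) - x) \<in> compact_ops \<and> (\<lambda>x. B (A x) - x) \<in> compact_ops"
    if "bounded_right_linear B" for B
    using that A by (auto simp: one mult eq bounded_right_linear_compose)
  have "calkin_proj A \<in> Units (calkin :: ('v \<Rightarrow> 'v) set ring) \<longleftrightarrow>
    (\<exists>B. bounded_right_linear B \<and> calkin_proj B \<otimes>\<^bsub>calkin\<^esub> calkin_proj A = \<one>\<^bsub>calkin\<^esub> \<and>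
      calkin_proj A \<otimes>\<^bsub>calkin\<^esub> calkin_proj B = \<one>\<^bsub>calkin\<^esub>)"
    using A unfolding Units_def carrier by auto
  then show ?thesis using inverse by auto
qed

section \<open>Bounded preimages under a surjection\<close>

text \<open>The successive-approximation half of the open mapping theorem.  Each step replaces \<open>y\<close> by a
remainder of at most half its norm; the corrections form a series dominated by a geometric
series with sum \<open>2 C \<parallel>y\<parallel>\<close>, whose limit stays in \<open>S\<close> because \<open>S\<close> is closed.\<close>

lemma approximate_preimages_imp_preimages:
  fixes f :: "'a::banach \<Rightarrow> 'b::real_normed_vector"
  assumes f: "bounded_linear f" and S: "closed S" "subspace S"
    and approx: "\<And>y. \<exists>x\<in>S. norm x \<le> C * norm y \<and> norm (y - f x) \<le> norm y / 2"
    and "C \<ge> 0"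
  shows "\<exists>x\<in>S. f x = y \<and> norm x \<le> 2 * C * norm y"
proof -
  obtain g where g: "\<And>y. g y \<in> S" "\<And>y. norm (g y) \<le> C * norm y"
    "\<And>y. norm (y - f (g y)) \<le> norm y / 2"
    using approx by metis
  define r where "r n = ((\<lambda>y. y - f (g y)) ^^ n) y" for n
  have r_Suc: "r (Suc n) = r n - f (g (r n))" and r_0: "r 0 = y" for n
    by (simp_all add: r_def)
  have r_le: "norm (r n) \<le> norm y * (1/2) ^ n" for n
  proof (induction n)
    case (Suc n)
    show ?case using g(3)[of "r n"] Suc by (simp add: r_Suc)
  qed (simp add: r_0)
  have h_le: "norm (g (r n)) \<le> C * norm y * (1/2) ^ n" for n
    using g(2)[of "r n"] mult_left_mono[OF r_le[of n] \<open>C \<ge> 0\<close>] by simp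
  have geo: "(\<lambda>n. C * norm y * (1/2) ^ n) sums (C * norm y * 2)"
    using sums_mult[OF geometric_sums[of "1/2::real"], of "C * norm y"] by simp
  have sn: "summable (\<lambda>n. norm (g (r n)))"
    using h_le by (intro summable_comparison_test'[OF sums_summable[OF geo], of 0]) auto
  then have sg: "summable (\<lambda>n. g (r n))" by (rule summable_norm_cancel)
  let ?x = "\<Sum>n. g (r n)"
  have "(\<lambda>n. f (g (r n))) sums f ?x"
    by (rule bounded_linear.sums[OF f summable_sums[OF sg]])
  moreover have "r \<longlonglongrightarrow> 0"
  proof (rule Lim_null_comparison)
    show "\<forall>\<^sub>F n in sequentially. norm (r n) \<le> norm y * (1/2) ^ n" using r_le by simp
    show "(\<lambda>n. norm y * (1/2) ^ n) \<longlonglongrightarrow> 0"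
      by (intro tendsto_mult_right_zero LIMSEQ_power_zero) simp
  qed
  then have "(\<lambda>n. r n - r (Suc n)) sums (r 0 - 0)" by (rule telescope_sums')
  then have "(\<lambda>n. f (g (r n))) sums y" by (simp add: r_Suc r_0)
  ultimately have "f ?x = y" by (rule sums_unique2)
  moreover have "?x \<in> S"
  proof (rule closed_sequentially[OF S(1)])
    show "(\<lambda>n. \<Sum>k<n. g (r k)) \<longlonglongrightarrow> ?x" by (rule summable_LIMSEQ[OF sg])
    show "(\<Sum>k<n. g (r k)) \<in> S" for n using g(1) by (intro subspace_sum S)
  qed
  moreover have "norm ?x \<le> 2 * C * norm y"
    using order_trans[OF summable_norm[OF sn] suminf_le[OF h_le sn sums_summable[OF geo]]]
      sums_unique[OF geo] by (simp add: mult_ac)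
  ultimately show ?thesis by blast
qed

text \<open>The open mapping theorem for a map defined on a closed subspace.  By Baire's theorem the closure
of the image of some ball \<open>cball 0 n\<close> in \<open>S\<close> contains a ball around some \<open>y0\<close>; differences of two
approximations then yield approximate preimages of every small vector, hence of every vector by
scaling.\<close>

lemma bounded_preimages_of_surjection:
  fixes f :: "'a::banach \<Rightarrow> 'b::banach"
  assumes f: "bounded_linear f" and S: "closed S" "subspace S" and surj: "f ` S = UNIV"
  obtains C where "\<And>y. \<exists>x\<in>S. f x = y \<and> norm x \<le> C * norm y"
proof -
  define D where "D n = closure (f ` (S \<inter> cball 0 (real n)))" for n
  interpret f: bounded_linear f by (rule f)
  have "\<exists>n. interior (D n) \<noteq> {}"
  proof (rule ccontr)
    assume "\<nexists>n. interior (D n) \<noteq> {}"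
    then have "euclidean interior_of \<Union>(range D) = {}"
      by (intro Baire_category_alt) (auto simp: D_def completely_metrizable_space_euclidean)
    moreover have "\<Union>(range D) = UNIV"
    proof -
      have "y \<in> \<Union>(range D)" for y
      proof -
        obtain x where x: "x \<in> S" "y = f x" using surj by blast
        obtain n where "norm x \<le> real n" using real_arch_simple by blast
        then have "y \<in> f ` (S \<inter> cball 0 (real n))" using x by auto
        then have "y \<in> D n" unfolding D_def by (rule subsetD[OF closure_subset])
        then show ?thesis by blast
      qed
      then show ?thesis by blast
    qed
    ultimately show False by simp
  qed
  then obtain n y0 where "y0 \<in> interior (D n)" by blast
  then obtain r where r: "r > 0" "ball y0 r \<subseteq> D n"
    by (metis mem_interior)
  define C where "C = 4 * real n / r"
  have approx: "\<exists>x\<in>S. norm x \<le> C * norm y \<and> norm (y - f x) \<le> norm y / 2" for y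
  proof (cases "y = 0")
    case True
    then show ?thesis using S(2) by (intro bexI[of _ 0]) (auto simp: f.zero subspace_0)
  next
    case False
    \<comment> \<open>The factor \<open>k\<close> shrinks \<open>y\<close> to norm \<open>r/2\<close>, inside the ball around \<open>y0\<close>.\<close>
    define k where "k = r / (2 * norm y)"
    have k: "k > 0" using False r by (simp add: k_def)
    have "norm (k *\<^sub>R y) < r" using False r by (simp add: k_def)
    then have "y0 + k *\<^sub>R y \<in> D n" "y0 \<in> D n" using r by (auto simp: dist_norm)
    \<comment> \<open>The tolerance \<open>r/8\<close> for each of the two points leaves the error \<open>r/4 = k * norm y / 2\<close> for the difference.\<close>
    then obtain a b where a: "a \<in> S" "norm a \<le> real n" "norm (f a - (y0 + k *\<^sub>R y)) < r / 8"
      and b: "b \<in> S" "norm b \<le> real n" "norm (f b - y0) < r / 8"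
      using r(1) unfolding D_def closure_approachable dist_norm
      by (auto dest!: spec[of _ "r/8"])
    let ?x = "(1/k) *\<^sub>R (a - b)"
    have "norm (k *\<^sub>R y - f (a - b)) < r / 4"
    proof -
      have *: "k *\<^sub>R y - f (a - b) = (f b - y0) - (f a - (y0 + k *\<^sub>R y))"
        by (simp add: f.diff)
      show ?thesis unfolding *
        using a(3) b(3) norm_triangle_ineq4[of "f b - y0" "f a - (y0 + k *\<^sub>R y)"] by linarith
    qed
    moreover have "y - f ?x = (1/k) *\<^sub>R (k *\<^sub>R y - f (a - b))"
      using k by (simp add: f.scaleR f.diff scaleR_diff_right)
    ultimately have "norm (y - f ?x) \<le> (1/k) * (r / 4)"
      using k by (simp only: norm_scaleR) (intro mult_mono, auto)
    also have "\<dots> = norm y / 2" using r False by (simp add: k_def)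
    finally have 1: "norm (y - f ?x) \<le> norm y / 2" .
    have "norm (a - b) \<le> 2 * real n" using a(2) b(2) norm_triangle_ineq4[of a b] by simp
    then have "norm ?x \<le> (1/k) * (2 * real n)"
      using k by (simp only: norm_scaleR) (intro mult_mono, auto)
    also have "\<dots> = C * norm y" using r by (simp add: k_def C_def)
    finally show ?thesis using 1 a b S(2)
      by (intro bexI[of _ ?x]) (auto simp: subspace_diff subspace_scale)
  qed
  have "C \<ge> 0" using r by (simp add: C_def)
  then show ?thesis
    using approximate_preimages_imp_preimages[OF f S approx] that by blast
qed

section \<open>Fredholm operators and inverses modulo compact operators\<close>

lemma right_subspace_kernel: "bounded_right_linear A \<Longrightarrow> right_subspace {x. A x = 0}"
  by (simp add: right_subspace_def bounded_right_linear_simps scaleQ_zero_left)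

lemma right_subspace_range:
  assumes "bounded_right_linear A"
  shows "right_subspace (range A)"
  unfolding right_subspace_def
  using bounded_right_linear_simps[OF assms] by (auto intro: range_eqI) (metis rangeI)+

text \<open>With \<open>K = B A - 1\<close> and \<open>U = 1 + (K - P K)\<close>, a vector \<open>x\<close> of the kernel satisfies \<open>K x = - x\<close>,
hence \<open>U x = P x\<close>: the kernel lies in the image under \<open>V = U\<^sup>-\<^sup>1\<close> of the finite-dimensional range
of \<open>P\<close>.\<close>

lemma finite_dim_kernel_if_left_inverse_mod_compact:
  fixes A B :: "'v::right_quat_hilbert \<Rightarrow> 'v"
  assumes A: "bounded_right_linear A" and B: "bounded_right_linear B"
    and K: "(\<lambda>x. B (A x) - x) \<in> compact_ops"
  shows "finite_dim (right_space {x. A x = 0})"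
proof -
  let ?K = "\<lambda>x. B (A x) - x"
  obtain Y P where Y: "finite Y" and P: "bounded_right_linear P" "\<And>x. P x \<in> right_span Y"
    and le: "\<And>x. norm (?K x - P (?K x)) \<le> norm x / 2"
    using compact_operator_approximation[OF K] by blast
  have KL: "bounded_right_linear ?K" by (rule compact_ops_bounded_right_linear[OF K])
  obtain V where V: "\<And>x y. V (x + y) = V x + V y" "\<And>x q. V (x \<cdot>\<^sub>Q q) = V x \<cdot>\<^sub>Q q"
    "\<And>x. V (x + (?K x - P (?K x))) = x"
    by (rule identity_plus_contraction_inverse[OF bounded_right_linear_diff[OF KL
          bounded_right_linear_compose[OF P(1) KL]] le]) (rule that)
  have "{x. A x = 0} \<subseteq> right_span (V ` Y)"
  proof
    fix x assume "x \<in> {x. A x = 0}"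
    then have "x + (?K x - P (?K x)) = P x"
      by (simp add: bounded_right_linear_simps[OF B] bounded_right_linear_simps[OF P(1)])
    then have "x = V (P x)" using V(3)[of x] by simp
    then show "x \<in> right_span (V ` Y)" using right_span_image[OF Y V(1,2) P(2)] by metis
  qed
  then obtain S where "finite S" "S \<subseteq> {x. A x = 0}" "{x. A x = 0} = right_span S"
    using right_subspace_finitely_spanned[OF finite_imageI[OF Y] right_subspace_kernel[OF A]] by metis
  then show ?thesis using finite_dim_right_space_iff[OF right_subspace_kernel[OF A]] by blast
qed

text \<open>With \<open>K = A B - 1\<close> and \<open>U = 1 + (K - P K)\<close>, every \<open>v = U x\<close> equals \<open>A (B x)\<close> up to the term
\<open>- P (K x)\<close> in the finite-dimensional range of \<open>P\<close>.\<close>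

lemma finite_dim_cokernel_if_right_inverse_mod_compact:
  fixes A B :: "'v::right_quat_hilbert \<Rightarrow> 'v"
  assumes A: "bounded_right_linear A" and B: "bounded_right_linear B"
    and K: "(\<lambda>x. A (B x) - x) \<in> compact_ops"
  shows "finite_dim (right_quotient (range A))"
proof -
  let ?K = "\<lambda>x. A (B x) - x"
  obtain Y P where Y: "finite Y" and P: "bounded_right_linear P" "\<And>x. P x \<in> right_span Y"
    and le: "\<And>x. norm (?K x - P (?K x)) \<le> norm x / 2"
    using compact_operator_approximation[OF K] by blast
  have KL: "bounded_right_linear ?K" by (rule compact_ops_bounded_right_linear[OF K])
  obtain V where V: "\<And>y. V y + (?K (V y) - P (?K (V y))) = y"
    by (rule identity_plus_contraction_inverse[OF bounded_right_linear_diff[OF KL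
          bounded_right_linear_compose[OF P(1) KL]] le]) (rule that)
  have "\<exists>u\<in>right_span Y. v - u \<in> range A" for v
  proof (rule bexI)
    let ?u = "- P (?K (V v))"
    have "v - ?u = A (B (V v))" using V[of v] by (simp add: algebra_simps)
    then show "v - ?u \<in> range A" by simp
    show "?u \<in> right_span Y" by (intro right_subspace_minus right_subspace_right_span P(2))
  qed
  then show ?thesis using finite_dim_right_quotient_iff[OF right_subspace_range[OF A]] Y by blast
qed

text \<open>The operator \<open>B\<close> is the first component of the inverse of \<open>(x, w) \<mapsto> A x + w\<close> on
\<open>ker P \<times> ran Q\<close>, where \<open>P\<close> projects onto the kernel of \<open>A\<close> and \<open>Q\<close> onto a complement of the range.
The open mapping theorem bounds it; since decompositions are unique, it is right linear.\<close>

lemma fredholm_imp_inverse_mod_compact: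
  fixes A :: "'v::right_quat_hilbert \<Rightarrow> 'v"
  assumes "fredholm A"
  obtains B where "bounded_right_linear B"
    "(\<lambda>x. A (B x) - x) \<in> compact_ops" "(\<lambda>x. B (A x) - x) \<in> compact_ops"
proof -
  have A: "bounded_right_linear A" using assms by (simp add: fredholm_def)
  note AL = bounded_right_linear_simps[OF A]
  obtain S where S: "finite S" "{x. A x = 0} = right_span S"
    using assms finite_dim_right_space_iff[OF right_subspace_kernel[OF A]]
    unfolding fredholm_def by blast
  obtain T0 where T0: "finite T0" "\<And>v. \<exists>u\<in>right_span T0. v - u \<in> range A"
    using assms finite_dim_right_quotient_iff[OF right_subspace_range[OF A]]
    unfolding fredholm_def by blast
  obtain T where T: "finite T" "right_span T \<inter> range A = {0}"
    "\<And>v. v \<in> right_span T0 \<Longrightarrow> \<exists>u\<in>right_span T. v - u \<in> range A"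
    using finite_complement_modulo[OF T0(1) right_subspace_range[OF A]] by blast
  obtain P where P0: "P \<in> compact_ops" "\<And>x. P x \<in> right_span S"
    "\<And>x. x \<in> right_span S \<Longrightarrow> P x = x"
    by (rule compact_projection_right_span[OF S(1)]) (rule that)
  have P: "P \<in> compact_ops" "A (P x) = 0" "A x = 0 \<Longrightarrow> P x = x" for x
    using P0 unfolding S(2)[symmetric] by auto
  obtain Q where Q: "Q \<in> compact_ops" "\<And>x. Q x \<in> right_span T"
    "\<And>x. x \<in> right_span T \<Longrightarrow> Q x = x"
    by (rule compact_projection_right_span[OF T(1)]) (rule that)
  note PB = compact_ops_bounded_right_linear[OF P(1)]
  note QB = compact_ops_bounded_right_linear[OF Q(1)]
  note PL = bounded_right_linear_simps[OF PB] and QL = bounded_right_linear_simps[OF QB]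
  \<comment> \<open>\<open>?D\<close> is \<open>ker P \<times> ran Q\<close>, written by equations that make it visibly closed.\<close>
  let ?D = "{z. P (fst z) = 0 \<and> Q (snd z) = snd z}" and ?F = "\<lambda>z. A (fst z) + snd z"
  \<comment> \<open>The complement meets the range trivially and \<open>P\<close> is injective on the kernel.\<close>
  have unique: "x = x' \<and> w = w'"
    if "P x = 0" "Q w = w" "P x' = 0" "Q w' = w'" "A x + w = A x' + w'" for x w x' w'
  proof -
    have "w' - w = A (x - x')" using that(5) by (simp add: AL algebra_simps)
    moreover have "w' - w \<in> right_span T"
      using Q(2)[of "w' - w"] that by (simp add: QL)
    ultimately have "w' - w \<in> right_span T \<inter> range A" by simp
    then have w: "w' - w = 0" using T(2) by simp
    then have "P (x - x') = x - x'" using \<open>w' - w = A (x - x')\<close> by (intro P(3)) simp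
    then show ?thesis using that w by (simp add: PL)
  qed
  have cont: "continuous_on UNIV (\<lambda>z. G (h z))"
    if "bounded_right_linear G" "continuous_on UNIV h" for G :: "'v \<Rightarrow> 'v" and h :: "'v \<times> 'v \<Rightarrow> 'v"
    using that by (auto simp: bounded_right_linear_def intro: bounded_linear.continuous_on)
  have "closed ?D"
    using cont[OF PB continuous_on_fst[OF continuous_on_id]] cont[OF QB continuous_on_snd[OF continuous_on_id]]
    by (intro closed_Collect_conj closed_Collect_eq) (auto intro!: continuous_on_snd)
  moreover have "subspace ?D"
    by (auto simp: subspace_def PL QL scaleR_scaleQ scaleQ_zero_left)
  moreover have "bounded_linear ?F"
    using A bounded_linear_compose[of A fst, OF _ bounded_linear_fst]
    by (intro bounded_linear_add) (auto simp: bounded_right_linear_def bounded_linear_snd)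
  moreover have "?F ` ?D = UNIV"
  proof -
    have "v \<in> ?F ` ?D" for v
    proof -
      obtain u0 where u0: "u0 \<in> right_span T0" "v - u0 \<in> range A" using T0(2) by blast
      obtain u where u: "u \<in> right_span T" "u0 - u \<in> range A" using T(3)[OF u0(1)] by blast
      obtain x y where "v - u0 = A x" "u0 - u = A y" using u0 u by blast
      then have "v = A (x + y - P (x + y)) + u" by (simp add: AL P(2) algebra_simps)
      moreover have "P (x + y - P (x + y)) = 0" using P(3)[OF P(2)] by (simp add: PL)
      ultimately show ?thesis
        using Q(3)[OF u(1)] by (intro image_eqI[of _ _ "(x + y - P (x + y), u)"]) auto
    qed
    then show ?thesis by blast
  qed
  ultimately obtain C where "\<And>y. \<exists>z\<in>?D. ?F z = y \<and> norm z \<le> C * norm y"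
    using bounded_preimages_of_surjection[of ?F ?D] by blast
  then have "\<forall>y. \<exists>z. z \<in> ?D \<and> ?F z = y \<and> norm z \<le> C * norm y" by blast
  from choice[OF this] obtain g where
    "\<forall>y. g y \<in> ?D \<and> ?F (g y) = y \<and> norm (g y) \<le> C * norm y" ..
  then have g: "g y \<in> ?D" "?F (g y) = y" "norm (g y) \<le> C * norm y" for y by blast+
  define B where "B y = fst (g y)" for y
  define W where "W y = snd (g y)" for y
  have PB0: "P (B y) = 0" and QW: "Q (W y) = W y" and AB: "A (B y) + W y = y" for y
    using g(1,2)[of y] by (auto simp: B_def W_def)
  have B_eq: "B y = x" if "P x = 0" "Q w = w" "A x + w = y" for x w y
    using unique[OF PB0 QW that(1,2)] AB that(3) by metis
  have B: "bounded_right_linear B"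
  proof (rule bounded_right_linearI)
    show "B (x + y) = B x + B y" for x y
    proof (rule B_eq)
      have "A (B x + B y) + (W x + W y) = (A (B x) + W x) + (A (B y) + W y)"
        by (simp add: AL algebra_simps)
      then show "A (B x + B y) + (W x + W y) = x + y" by (simp add: AB)
    qed (simp_all add: PL QL PB0 QW)
    show "B (x \<cdot>\<^sub>Q q) = B x \<cdot>\<^sub>Q q" for x q
    proof (rule B_eq)
      show "A (B x \<cdot>\<^sub>Q q) + W x \<cdot>\<^sub>Q q = x \<cdot>\<^sub>Q q"
        by (simp add: AL scaleQ_add_left[symmetric] AB)
    qed (simp_all add: PL QL PB0 QW scaleQ_zero_left)
    show "norm (B y) \<le> norm y * C" for y
      using norm_fst_le[of "fst (g y)" "snd (g y)"] g(3)[of y] by (simp add: B_def mult.commute)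
  qed
  \<comment> \<open>The defect \<open>A B - 1\<close> takes values in \<open>ran Q\<close>, so composing with the compact \<open>Q\<close> does not change it.\<close>
  have "A (B x) - x = Q (A (B x) - x)" for x
  proof -
    have "A (B x) - x = - W x" using AB[of x] by (simp add: algebra_simps)
    then show ?thesis by (simp add: QL QW)
  qed
  then have "(\<lambda>x. A (B x) - x) = (\<lambda>x. Q (A (B x) - x))" by blast
  also have "\<dots> \<in> compact_ops"
    by (rule compact_ops_compose_right[OF Q(1) bounded_right_linear_diff[OF
            bounded_right_linear_compose[OF A B] bounded_right_linear_id]])
  finally have 1: "(\<lambda>x. A (B x) - x) \<in> compact_ops" .
  \<comment> \<open>\<open>A x = A (x - P x) + 0\<close> is the decomposition of \<open>A x\<close>.\<close>
  have "B (A x) = x - P x" for x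
    by (rule B_eq[of _ 0]) (simp_all add: PL QL AL P(2) P(3)[OF P(2)])
  then have "(\<lambda>x. B (A x) - x) = (\<lambda>x. - P x)" by simp
  then have "(\<lambda>x. B (A x) - x) \<in> compact_ops" using compact_ops_uminus[OF P(1)] by simp
  then show ?thesis using that B 1 by blast
qed

theorem corollary7p9:
  fixes A :: "'v::right_quat_hilbert \<Rightarrow> 'v"
  assumes "separable_space (euclidean :: 'v topology)"
    and "bounded_right_linear A"
  shows "fredholm A \<longleftrightarrow> calkin_proj A \<in> Units (calkin :: ('v \<Rightarrow> 'v) set ring)"
proof
  assume "fredholm A"
  then show "calkin_proj A \<in> Units (calkin :: ('v \<Rightarrow> 'v) set ring)"
    unfolding calkin_proj_Units_iff[OF assms(2)]
    by (blast elim: fredholm_imp_inverse_mod_compact)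
next
  assume "calkin_proj A \<in> Units (calkin :: ('v \<Rightarrow> 'v) set ring)"
  then obtain B where B: "bounded_right_linear B"
    "(\<lambda>x. A (B x) - x) \<in> compact_ops" "(\<lambda>x. B (A x) - x) \<in> compact_ops"
    unfolding calkin_proj_Units_iff[OF assms(2)] by blast
  then show "fredholm A"
    unfolding fredholm_def using assms(2)
      finite_dim_kernel_if_left_inverse_mod_compact[OF assms(2) B(1,3)]
      finite_dim_cokernel_if_right_inverse_mod_compact[OF assms(2) B(1,2)] by blast
qed

end
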